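(* Let $P\subseteq[0,1]^n$ be a polytope and let $t$ be a positive integer with $0<t\le n$. Then the $t$-branch split rank of $P$ is at most $\lceil \frac{n}{t}\rceil$, and the $t$-dimensional lattice rank of $P$ is at most $\lceil\frac{n}{t}\rceil$.
   Context: For $P\subseteq\mathbb{R}^n$, writing $\pi x$ for the inner product of $\pi$ and $x$: The $t$-branch split closure of $P$ is $$tSC(P)=\bigcap_{\pi^1,\dots,\pi^t\in\mathbb{Z}^n,\ \pi^1_0,\dots,\pi^t_0\in\mathbb{Z}}\mathrm{conv}\Big(\bigcap_{j=1}^t\big(\{x\in P:\pi^jx\le\pi^j_0\}\cup\{x\in P:\pi^jx\ge\pi^j_0+1\}\big)\Big).$$ The $t$-dimensional lattice closure of $P$ is $$tLC(P)=\bigcap_{\pi^1,\dots,\pi^t\in\mathbb{Z}^n}\mathrm{conv}\Big(\bigcap_{j=1}^t\{x\in P:\pi^j x\in\mathbb{Z}\}\Big).$$ Put $tSC^0(P)=P$, $tSC^k(P)=tSC(tSC^{k-1}(P))$ for $k\ge1$, and define $tLC^k(P)$ analogously. Let $P_I$ denote the convex hull of the integral points of $P$. The $t$-branch split rank (respectively $t$-dimensional lattice rank) of $P$ is the minimum $k\ge0$ such that $tSC^k(P)=P_I$ (respectively $tLC^k(P)=P_I$). *)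

theory Defs
  imports "HOL-Analysis.Analysis" "HOL-Library.Extended_Nat"
begin

definition int_inner :: "int ^ 'n \<Rightarrow> real ^ 'n \<Rightarrow> real" where
  "int_inner \<pi> x = (\<chi> i. real_of_int (\<pi> $ i)) \<bullet> x"

definition integer_hull :: "(real ^ 'n) set \<Rightarrow> (real ^ 'n) set" where
  "integer_hull P = convex hull {x \<in> P. \<forall>i. x $ i \<in> \<int>}"

text \<open>
  In both closures a \<open>t\<close>-tuple is a function on \<open>nat\<close>, of which only the values at
  \<open>1, \<dots>, t\<close> are used. The definitions are meant for \<open>t \<ge> 1\<close>.
\<close>

definition split_closure :: "nat \<Rightarrow> (real ^ 'n) set \<Rightarrow> (real ^ 'n) set" where
  "split_closure t P =
    (\<Inter>(\<pi> :: nat \<Rightarrow> int ^ 'n) (\<pi>0 :: nat \<Rightarrow> int).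
      convex hull (\<Inter>j\<in>{1..t}.
        {x \<in> P. int_inner (\<pi> j) x \<le> real_of_int (\<pi>0 j)} \<union>
        {x \<in> P. int_inner (\<pi> j) x \<ge> real_of_int (\<pi>0 j) + 1}))"

definition lattice_closure :: "nat \<Rightarrow> (real ^ 'n) set \<Rightarrow> (real ^ 'n) set" where
  "lattice_closure t P =
    (\<Inter>\<pi> :: nat \<Rightarrow> int ^ 'n.
      convex hull (\<Inter>j\<in>{1..t}. {x \<in> P. int_inner (\<pi> j) x \<in> \<int>}))"

text \<open>
  The ranks are extended naturals: the infimum is the minimum of the set of admissible \<open>k\<close>
  if this set is nonempty, and \<open>\<infinity>\<close> otherwise.
\<close>

definition split_rank :: "nat \<Rightarrow> (real ^ 'n) set \<Rightarrow> enat" where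
  "split_rank t P = Inf (enat ` {k. (split_closure t ^^ k) P = integer_hull P})"

definition lattice_rank :: "nat \<Rightarrow> (real ^ 'n) set \<Rightarrow> enat" where
  "lattice_rank t P = Inf (enat ` {k. (lattice_closure t ^^ k) P = integer_hull P})"

end

theory Submission
  imports Defs
begin

text \<open>
  The proof is Balas' sequential convexification, carried out on blocks of \<open>t\<close> coordinates.
  Applied to the coordinate directions \<open>e\<^sub>i\<close>, \<open>i \<in> B\<close>, with \<open>card B \<le> t\<close>, either closure sends a set
  \<open>Q\<close> in the unit cube into the convex hull of the points of \<open>Q\<close> whose coordinates in \<open>B\<close> are
  integral: inside the cube, \<open>x\<^sub>i \<le> 0\<close> or \<open>x\<^sub>i \<ge> 1\<close> means \<open>x\<^sub>i \<in> {0, 1}\<close>. The integrality achieved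
  in one round survives the next ones, because fixing a coordinate to \<open>0\<close> or \<open>1\<close> cuts out a face
  of the cube, and intersecting with a face commutes with taking convex hulls
  (\<open>convex_hull_integral_coords\<close>). Hence \<open>k\<close> rounds make any \<open>k * t\<close> coordinates integral, and
  \<open>\<lceil>n / t\<rceil>\<close> rounds all of them. Conversely neither closure loses an integral point, and their values
  are convex, so the integer hull is always contained in the iterates.

  Only three properties of the closures enter this argument; the predicate
  \<open>block_convexifier\<close> collects them, so that both ranks are bounded by the same proof.
\<close>

section \<open>Integral coordinates and convex hulls in the unit cube\<close>

abbreviation (input) unit_cube :: "(real ^ 'n) set" where
  "unit_cube \<equiv> {x. \<forall>i. 0 \<le> x $ i \<and> x $ i \<le> 1}"

lemma Ints_unit_interval:
  fixes r :: real
  assumes "r \<in> \<int>" "0 \<le> r" "r \<le> 1"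
  shows "r = 0 \<or> r = 1"
  using assms by (auto elim!: Ints_cases)

lemma convex_unit_cube: "convex (unit_cube :: (real ^ 'n) set)"
proof -
  have "unit_cube = cbox (0 :: real ^ 'n) 1"
    by (auto simp: cbox_def Basis_vec_def inner_axis)
  then show ?thesis
    by simp
qed

text \<open>
  If a convex combination takes the extreme value \<open>0\<close> or \<open>1\<close> in some coordinate, then so does every
  point that enters it with positive weight.
\<close>

lemma convex_hull_integral_coords:
  fixes Q :: "(real ^ 'n) set"
  assumes cube: "Q \<subseteq> unit_cube" and x: "x \<in> convex hull Q" and int: "\<forall>i\<in>B. x $ i \<in> \<int>"
  shows "x \<in> convex hull {y \<in> Q. \<forall>i\<in>B. y $ i \<in> \<int>}"
proof -
  obtain S u where S: "finite S" "S \<subseteq> Q" and u: "\<forall>y\<in>S. 0 \<le> u y" "sum u S = 1"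
    and xS: "(\<Sum>y\<in>S. u y *\<^sub>R y) = x"
    using x unfolding convex_hull_explicit by blast
  define T where "T = {y \<in> S. u y \<noteq> 0}"
  have T: "finite T" "T \<subseteq> S"
    using S by (auto simp: T_def)
  have sumT: "sum u T = 1"
    unfolding u(2)[symmetric] using S(1) T(2) by (rule sum.mono_neutral_left) (simp add: T_def)
  have xT: "(\<Sum>y\<in>T. u y *\<^sub>R y) = x"
    unfolding xS[symmetric] using S(1) T(2) by (rule sum.mono_neutral_left) (simp add: T_def)
  have bounds: "0 \<le> y $ i \<and> y $ i \<le> 1" if "y \<in> S" for y i
    using that S cube by auto
  have "y $ i \<in> \<int>" if y: "y \<in> T" and i: "i \<in> B" for y i
  proof -
    have yS: "y \<in> S" "u y \<noteq> 0"
      using y by (auto simp: T_def)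
    have xi: "x $ i = (\<Sum>y\<in>S. u y * y $ i)"
      by (simp flip: xS)
    have "x $ i \<in> {0..1}"
      using x convex_unit_cube cube hull_minimal[of Q unit_cube convex] by auto
    then consider "x $ i = 0" | "x $ i = 1"
      using int i Ints_unit_interval[of "x $ i"] by auto
    then show ?thesis
    proof cases
      case 1
      then have "\<forall>y\<in>S. u y * y $ i = 0"
        using xi S u bounds by (subst sum_nonneg_eq_0_iff[symmetric]) auto
      then show ?thesis
        using yS by auto
    next
      case 2
      then have "(\<Sum>y\<in>S. u y * (1 - y $ i)) = 0"
        using xi u by (simp add: algebra_simps sum_subtractf)
      then have "\<forall>y\<in>S. u y * (1 - y $ i) = 0"
        using S u bounds by (subst sum_nonneg_eq_0_iff[symmetric]) auto
      then show ?thesis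
        using yS by auto
    qed
  qed
  then have "T \<subseteq> {y \<in> Q. \<forall>i\<in>B. y $ i \<in> \<int>}"
    using T S by auto
  then have "finite T \<and> T \<subseteq> {y \<in> Q. \<forall>i\<in>B. y $ i \<in> \<int>} \<and> (\<forall>y\<in>T. 0 \<le> u y) \<and> sum u T = 1 \<and>
      (\<Sum>y\<in>T. u y *\<^sub>R y) = x"
    using T u(1) sumT xT by auto
  then show ?thesis
    unfolding convex_hull_explicit by (intro CollectI exI)
qed

section \<open>Iterating an operator that convexifies blocks of coordinates\<close>

definition block_convexifier :: "nat \<Rightarrow> ((real ^ 'n) set \<Rightarrow> (real ^ 'n) set) \<Rightarrow> bool" where
  "block_convexifier t C \<longleftrightarrow>
    (\<forall>Q. convex (C Q)) \<and>
    (\<forall>Q. {x \<in> Q. \<forall>i. x $ i \<in> \<int>} \<subseteq> C Q) \<and>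
    (\<forall>Q B. Q \<subseteq> unit_cube \<longrightarrow> card B \<le> t \<longrightarrow> C Q \<subseteq> convex hull {x \<in> Q. \<forall>i\<in>B. x $ i \<in> \<int>})"

lemma integer_hull_subset_iterate:
  assumes C: "block_convexifier t C" and P: "convex P"
  shows "integer_hull P \<subseteq> (C ^^ k) P"
proof -
  have "convex ((C ^^ k) P)"
    using C P by (cases k) (auto simp: block_convexifier_def)
  moreover have "{x \<in> P. \<forall>i. x $ i \<in> \<int>} \<subseteq> (C ^^ k) P"
  proof (induction k)
    case (Suc k)
    then have "{x \<in> P. \<forall>i. x $ i \<in> \<int>} \<subseteq> {x \<in> (C ^^ k) P. \<forall>i. x $ i \<in> \<int>}"
      by auto
    also have "\<dots> \<subseteq> C ((C ^^ k) P)"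
      using C by (simp add: block_convexifier_def)
    finally show ?case
      by simp
  qed auto
  ultimately show ?thesis
    unfolding integer_hull_def by (intro hull_minimal)
qed

text \<open>
  A set of at most \<open>(k + 1) * t\<close> coordinates splits into at most \<open>k * t\<close> coordinates, which the
  first \<open>k\<close> rounds make integral, and a block \<open>B\<close> of at most \<open>t\<close>, which the last round takes care of.
  The integrality on \<open>B\<close> is moved inside the convex hull produced by the earlier rounds.
\<close>

lemma iterate_subset_convex_hull:
  fixes P :: "(real ^ 'n) set" and S :: "'n set"
  assumes C: "block_convexifier t C" and P: "convex P" "P \<subseteq> unit_cube" and "card S \<le> k * t"
  shows "(C ^^ k) P \<subseteq> convex hull {x \<in> P. \<forall>i\<in>S. x $ i \<in> \<int>}"
  using assms(4)
proof (induction k arbitrary: S)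
  case 0
  then show ?case
    using hull_subset[of P convex] by simp
next
  case (Suc k)
  obtain S' where S': "S' \<subseteq> S" "card S' = min (card S) (k * t)"
    using obtain_subset_with_card_n[of "min (card S) (k * t)" S] by auto
  define B where "B = S - S'"
  have S_eq: "S = S' \<union> B"
    using S' by (auto simp: B_def)
  have card_B: "card B \<le> t"
    using S' Suc.prems by (auto simp: B_def card_Diff_subset)
  define Q where "Q = {x \<in> P. \<forall>i\<in>S'. x $ i \<in> \<int>}"
  have IH: "(C ^^ k) P \<subseteq> convex hull Q"
    unfolding Q_def using Suc.IH[of S'] S' by simp
  have Q: "Q \<subseteq> unit_cube"
    using P by (auto simp: Q_def)
  have "(C ^^ k) P \<subseteq> unit_cube"
    using IH hull_minimal[of Q unit_cube convex] Q convex_unit_cube by blast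
  then have "(C ^^ Suc k) P \<subseteq> convex hull {x \<in> (C ^^ k) P. \<forall>i\<in>B. x $ i \<in> \<int>}"
    using C card_B by (simp add: block_convexifier_def)
  also have "\<dots> \<subseteq> convex hull {x \<in> Q. \<forall>i\<in>B. x $ i \<in> \<int>}"
  proof (rule hull_minimal)
    show "{x \<in> (C ^^ k) P. \<forall>i\<in>B. x $ i \<in> \<int>} \<subseteq> convex hull {x \<in> Q. \<forall>i\<in>B. x $ i \<in> \<int>}"
      using IH convex_hull_integral_coords[OF Q] by blast
  qed (rule convex_convex_hull)
  also have "{x \<in> Q. \<forall>i\<in>B. x $ i \<in> \<int>} = {x \<in> P. \<forall>i\<in>S. x $ i \<in> \<int>}"
    by (auto simp: Q_def S_eq)
  finally show ?case .
qed

theorem iterate_eq_integer_hull: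
  fixes P :: "(real ^ 'n) set"
  assumes "block_convexifier t C" and "convex P" and "P \<subseteq> unit_cube" and "CARD('n) \<le> k * t"
  shows "(C ^^ k) P = integer_hull P"
  using iterate_subset_convex_hull[OF assms] integer_hull_subset_iterate[OF assms(1,2)]
  by (auto simp: integer_hull_def)

section \<open>The split and lattice closures convexify blocks\<close>

lemma int_inner_axis: "int_inner (axis i 1) x = x $ i"
proof -
  have "(\<chi> k. real_of_int (axis i 1 $ k)) = axis i (1 :: real)"
    by (simp add: vec_eq_iff axis_def)
  then show ?thesis
    by (simp add: int_inner_def inner_axis')
qed

lemma int_inner_integral:
  assumes "\<forall>i. x $ i \<in> \<int>"
  shows "int_inner \<pi> x \<in> \<int>"
  using assms unfolding int_inner_def inner_vec_def
  by (auto intro!: Ints_sum Ints_mult)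

text \<open>
  The \<open>t\<close>-tuple of directions that serves a block \<open>B\<close>. When \<open>B\<close> has fewer than \<open>t\<close> elements, the
  remaining directions are arbitrary: they can only make the closure smaller.
\<close>

lemma coordinate_directions:
  fixes B :: "'n::finite set"
  assumes "card B \<le> t"
  obtains \<pi> :: "nat \<Rightarrow> int ^ 'n"
  where "\<And>i. i \<in> B \<Longrightarrow> \<exists>j\<in>{1..t}. \<forall>x. int_inner (\<pi> j) x = x $ i"
proof -
  obtain h where h: "bij_betw h {1..card B} B"
    using ex_bij_betw_nat_finite_1[of B] by auto
  have "\<exists>j\<in>{1..t}. \<forall>x. int_inner (axis (h j) 1) x = x $ i" if i: "i \<in> B" for i
  proof -
    have "i \<in> h ` {1..card B}"
      unfolding bij_betw_imp_surj_on[OF h] by (rule i)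
    then obtain j where j: "j \<in> {1..card B}" "h j = i"
      by blast
    then have "j \<in> {1..t}"
      using assms by simp
    moreover have "\<forall>x. int_inner (axis (h j) 1) x = x $ i"
      by (simp add: int_inner_axis j)
    ultimately show ?thesis
      by (rule bexI[rotated])
  qed
  then show ?thesis
    using that[of "\<lambda>j. axis (h j) 1"] by blast
qed

lemma block_convexifier_split_closure:
  assumes "0 < t"
  shows "block_convexifier t (split_closure t :: (real ^ 'n) set \<Rightarrow> _)"
  unfolding block_convexifier_def
proof (intro conjI allI impI)
  fix Q :: "(real ^ 'n) set"
  show "convex (split_closure t Q)"
    unfolding split_closure_def by (intro convex_INT convex_convex_hull)
  have "int_inner p x \<le> real_of_int p0 \<or> int_inner p x \<ge> real_of_int p0 + 1"
    if x: "\<forall>i. x $ i \<in> \<int>" for p p0 and x :: "real ^ 'n"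
  proof -
    obtain z where "int_inner p x = real_of_int z"
      using int_inner_integral[OF x] by (auto elim: Ints_cases)
    then show ?thesis
      by (cases "z \<le> p0") auto
  qed
  then show "{x \<in> Q. \<forall>i. x $ i \<in> \<int>} \<subseteq> split_closure t Q"
    unfolding split_closure_def by (auto intro!: hull_inc)
next
  fix Q :: "(real ^ 'n) set" and B :: "'n set"
  assume Q: "Q \<subseteq> unit_cube" and B: "card B \<le> t"
  obtain \<pi> :: "nat \<Rightarrow> int ^ 'n"
    where \<pi>: "\<And>i. i \<in> B \<Longrightarrow> \<exists>j\<in>{1..t}. \<forall>x. int_inner (\<pi> j) x = x $ i"
    using coordinate_directions[OF B] by blast
  define D where "D j = {x \<in> Q. int_inner (\<pi> j) x \<le> real_of_int 0} \<union>
      {x \<in> Q. int_inner (\<pi> j) x \<ge> real_of_int 0 + 1}" for j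
  have "split_closure t Q \<subseteq> convex hull (\<Inter>j\<in>{1..t}. D j)"
    unfolding split_closure_def D_def
    by (rule INF_lower2[where i = \<pi>], simp, rule INF_lower2[where i = "\<lambda>_. 0"]) simp_all
  also have "\<dots> \<subseteq> convex hull {x \<in> Q. \<forall>i\<in>B. x $ i \<in> \<int>}"
  proof (intro hull_mono subsetI CollectI conjI ballI)
    fix x
    assume x: "x \<in> (\<Inter>j\<in>{1..t}. D j)"
    then have "x \<in> D 1"
      using assms by auto
    then show xQ: "x \<in> Q"
      by (auto simp: D_def)
    fix i
    assume "i \<in> B"
    then obtain j where "j \<in> {1..t}" and j: "int_inner (\<pi> j) x = x $ i"
      using \<pi> by blast
    then have "x \<in> D j"
      using x by blast
    then have "x $ i \<le> 0 \<or> x $ i \<ge> 1"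
      using j by (auto simp: D_def)
    moreover have "0 \<le> x $ i" "x $ i \<le> 1"
      using xQ Q by auto
    ultimately have "x $ i = 0 \<or> x $ i = 1"
      by linarith
    then show "x $ i \<in> \<int>"
      by auto
  qed
  finally show "split_closure t Q \<subseteq> convex hull {x \<in> Q. \<forall>i\<in>B. x $ i \<in> \<int>}" .
qed

lemma block_convexifier_lattice_closure:
  assumes "0 < t"
  shows "block_convexifier t (lattice_closure t :: (real ^ 'n) set \<Rightarrow> _)"
  unfolding block_convexifier_def
proof (intro conjI allI impI)
  fix Q :: "(real ^ 'n) set"
  show "convex (lattice_closure t Q)"
    unfolding lattice_closure_def by (intro convex_INT convex_convex_hull)
  show "{x \<in> Q. \<forall>i. x $ i \<in> \<int>} \<subseteq> lattice_closure t Q"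
    unfolding lattice_closure_def by (auto intro!: hull_inc int_inner_integral)
next
  fix Q :: "(real ^ 'n) set" and B :: "'n set"
  assume B: "card B \<le> t"
  obtain \<pi> :: "nat \<Rightarrow> int ^ 'n"
    where \<pi>: "\<And>i. i \<in> B \<Longrightarrow> \<exists>j\<in>{1..t}. \<forall>x. int_inner (\<pi> j) x = x $ i"
    using coordinate_directions[OF B] by blast
  define D where "D j = {x \<in> Q. int_inner (\<pi> j) x \<in> \<int>}" for j
  have "lattice_closure t Q \<subseteq> convex hull (\<Inter>j\<in>{1..t}. D j)"
    unfolding lattice_closure_def D_def by (rule INF_lower2[where i = \<pi>]) simp_all
  also have "\<dots> \<subseteq> convex hull {x \<in> Q. \<forall>i\<in>B. x $ i \<in> \<int>}"
  proof (intro hull_mono subsetI CollectI conjI ballI)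
    fix x
    assume x: "x \<in> (\<Inter>j\<in>{1..t}. D j)"
    then have "x \<in> D 1"
      using assms by auto
    then show "x \<in> Q"
      by (auto simp: D_def)
    fix i
    assume "i \<in> B"
    then obtain j where "j \<in> {1..t}" and j: "int_inner (\<pi> j) x = x $ i"
      using \<pi> by blast
    then have "x \<in> D j"
      using x by blast
    then show "x $ i \<in> \<int>"
      using j by (auto simp: D_def)
  qed
  finally show "lattice_closure t Q \<subseteq> convex hull {x \<in> Q. \<forall>i\<in>B. x $ i \<in> \<int>}" .
qed

section \<open>The rank bound\<close>

theorem theorem2:
  fixes P :: "(real ^ 'n) set" and t :: nat
  assumes "polytope P"
    and "P \<subseteq> {x. \<forall>i. 0 \<le> x $ i \<and> x $ i \<le> 1}"
    and "0 < t" and "t \<le> CARD('n)"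
  shows "split_rank t P \<le> enat (nat \<lceil>real CARD('n) / real t\<rceil>) \<and>
         lattice_rank t P \<le> enat (nat \<lceil>real CARD('n) / real t\<rceil>)"
proof -
  define k where "k = nat \<lceil>real CARD('n) / real t\<rceil>"
  have "real CARD('n) / real t \<le> real k"
    unfolding k_def by (rule real_nat_ceiling_ge)
  then have "real CARD('n) \<le> real (k * t)"
    using \<open>0 < t\<close> by (simp add: divide_le_eq)
  then have k: "CARD('n) \<le> k * t"
    by (simp only: of_nat_le_iff)
  have P: "convex P"
    using \<open>polytope P\<close> by (rule polytope_imp_convex)
  note iterate = iterate_eq_integer_hull[OF _ P assms(2) k]
  have "split_rank t P \<le> enat k"
    unfolding split_rank_def
    using iterate[OF block_convexifier_split_closure[OF \<open>0 < t\<close>]]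
    by (intro Inf_lower imageI CollectI)
  moreover have "lattice_rank t P \<le> enat k"
    unfolding lattice_rank_def
    using iterate[OF block_convexifier_lattice_closure[OF \<open>0 < t\<close>]]
    by (intro Inf_lower imageI CollectI)
  ultimately show ?thesis
    unfolding k_def by (rule conjI)
qed

end
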